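(* Let $n$ be a positive integer. Let $d=a(b+c)=ab+ac\in\mathfrak A$ and define blocks $L_1,\dots,L_{2n}$ by $L_j=c$ for $j$ odd and $L_j=d$ for $j$ even. For $0\le i\le 2n$ put $S_i=L_{i+1}\star L_{i+2}\star\cdots\star L_{2n}$, and $P_i=L_1\star L_2\star\cdots\star L_i$ if $i$ is odd, $P_i=L_i\star L_{i-1}\star\cdots\star L_1$ if $i$ is even (an empty $\star$-product is the empty word $\mathbf 1$). Set $\Delta_i=P_i\sqcup\!\sqcup\, S_i-P_i* S_i$. Then the following identity holds in $\mathfrak A$: $$2^n(ac^2ab^2)^{\lfloor n/2\rfloor}(ac^2)^{2\{n/2\}}=(a^2(b+c))^n+\sum_{i=0}^{2n}(-1)^{n-i}\Delta_i ,$$ where $\lfloor x\rfloor$ and $\{x\}$ denote the integral and fractional parts of $x$ (so $(ac^2)^{2\{n/2\}}$ is $ac^2$ if $n$ is odd and $\mathbf 1$ if $n$ is even), and all powers of words are ordinary concatenation powers.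
   Context: $\mathfrak A=\mathbb Q\langle a,b,c\rangle$ is the free noncommutative polynomial algebra over $\mathbb Q$ on letters $a,b,c$; words are monomials, $\mathbf 1$ is the empty word. For $k\ge1$ put $\beta_k=a^{k-1}b$, $\gamma_k=a^{k-1}c$. $\mathfrak A^1$ is the $\mathbb Q$-span of words not ending in $a$; each such word factors uniquely as a product of $\beta_k$'s and $\gamma_k$'s. Shuffle product $\sqcup\!\sqcup$ on $\mathfrak A$: bilinear, $\mathbf 1\sqcup\!\sqcup w=w\sqcup\!\sqcup\mathbf 1=w$, and $(xu)\sqcup\!\sqcup(yv)=x(u\sqcup\!\sqcup yv)+y(xu\sqcup\!\sqcup v)$ for letters $x,y\in\{a,b,c\}$ and words $u,v$. Stuffle product $*$ on $\mathfrak A^1$: define the linear maps $M_{\beta_k}=\mathrm{id}$ and $M_{\gamma_k}=$ the algebra automorphism swapping the letters $b$ and $c$ (fixing $a$). Define $[\beta_m,\beta_n]=[\gamma_m,\gamma_n]=\beta_{m+n}$, $[\beta_m,\gamma_n]=[\gamma_m,\beta_n]=\gamma_{m+n}$. Then $*$ is bilinear, $\mathbf 1*w=w*\mathbf 1=w$, and for $x,y\in\{\beta_k,\gamma_k:k\ge1\}$ and words $w_1,w_2\in\mathfrak A^1$: $xw_1*yw_2=x\,M_x\big(M_x(w_1)*yw_2\big)+y\,M_y\big(xw_1*M_y(w_2)\big)+[x,y]\,M_{[x,y]}\big(M_x(w_1)*M_y(w_2)\big)$. $\star$-concatenation: for words $u,v$, if $u$ ends in $b$ and $v=bv'$, then $u\star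 v=u\,c\,v'$; if $u$ ends in $c$ and $v=cv'$, then $u\star v=u\,b\,v'$; otherwise $u\star v=uv$ (so $b\star b=bc$, $c\star c=cb$). Extend bilinearly; iterated $\star$-products are evaluated left to right. E.g. $d\star c=abc+acb$. *)

theory Defs
  imports Complex_Main "HOL-Library.Poly_Mapping"
begin

section \<open>The free algebra on three letters\<close>

text \<open>
  Words form the free monoid; it is written additively because the convolution product of
  \<^typ>\<open>'k \<Rightarrow>\<^sub>0 'r\<close> requires an additive monoid of exponents. The product on
  \<open>letter list \<Rightarrow>\<^sub>0 rat\<close> is thus concatenation, and \<open>1\<close> is the empty word.
\<close>

instantiation list :: (type) monoid_add
begin

definition zero_list :: "'a list" where "zero_list = []"

definition plus_list :: "'a list \<Rightarrow> 'a list \<Rightarrow> 'a list" where "plus_list u v = u @ v"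

instance
  by standard (simp_all add: zero_list_def plus_list_def)

end

datatype letter = La | Lb | Lc

type_synonym alg = "letter list \<Rightarrow>\<^sub>0 rat"

definition monomial :: "letter list \<Rightarrow> alg" where
  "monomial w = Poly_Mapping.single w 1"

definition xa :: alg where "xa = monomial [La]"
definition xb :: alg where "xb = monomial [Lb]"
definition xc :: alg where "xc = monomial [Lc]"

lemma monomial_Nil: "monomial [] = 1"
  by (simp add: monomial_def flip: zero_list_def)

lemma monomial_append: "monomial (u @ v) = monomial u * monomial v"
  by (simp add: monomial_def mult_single plus_list_def)

text \<open>Linear and bilinear extension of maps given on words; \<open>single 0 r * p\<close> is the scalar
  multiple of \<open>p\<close> by \<open>r\<close>.\<close>

definition lin_ext :: "(letter list \<Rightarrow> alg) \<Rightarrow> alg \<Rightarrow> alg" where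
  "lin_ext f p = (\<Sum>w\<in>Poly_Mapping.keys p. Poly_Mapping.single 0 (Poly_Mapping.lookup p w) * f w)"

definition bilin_ext :: "(letter list \<Rightarrow> letter list \<Rightarrow> alg) \<Rightarrow> alg \<Rightarrow> alg \<Rightarrow> alg" where
  "bilin_ext f p q = lin_ext (\<lambda>u. lin_ext (f u) q) p"

lemma lin_ext_mono: "lin_ext f (monomial w) = f w"
  by (simp add: lin_ext_def monomial_def)

lemma bilin_ext_mono: "bilin_ext f (monomial u) (monomial v) = f u v"
  by (simp add: bilin_ext_def lin_ext_mono)


section \<open>Shuffle product\<close>

fun shuffle_word :: "letter list \<Rightarrow> letter list \<Rightarrow> alg" where
  "shuffle_word [] v = monomial v"
| "shuffle_word u [] = monomial u"
| "shuffle_word (x # u) (y # v) =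
     monomial [x] * shuffle_word u (y # v) + monomial [y] * shuffle_word (x # u) v"

definition shuffle :: "alg \<Rightarrow> alg \<Rightarrow> alg" where
  "shuffle = bilin_ext shuffle_word"


section \<open>Stuffle product\<close>

text \<open>\<open>Beta k\<close> and \<open>Gamma k\<close> stand for $\beta_k = a^{k-1} b$ and $\gamma_k = a^{k-1} c$;
  only indices \<open>k \<ge> 1\<close> are meaningful.\<close>

datatype gen = Beta nat | Gamma nat

fun gen_index :: "gen \<Rightarrow> nat" where
  "gen_index (Beta k) = k"
| "gen_index (Gamma k) = k"

fun gen_word :: "gen \<Rightarrow> letter list" where
  "gen_word (Beta k) = replicate (k - 1) La @ [Lb]"
| "gen_word (Gamma k) = replicate (k - 1) La @ [Lc]"

definition gens_word :: "gen list \<Rightarrow> letter list" where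
  "gens_word zs = concat (map gen_word zs)"

text \<open>The factorisation of a word not ending in \<open>a\<close> into generators; the first argument counts
  the letters \<open>a\<close> read since the last generator. On other words the trailing \<open>a\<close>'s are dropped
  (a junk value).\<close>

fun factor_aux :: "nat \<Rightarrow> letter list \<Rightarrow> gen list" where
  "factor_aux k [] = []"
| "factor_aux k (La # w) = factor_aux (Suc k) w"
| "factor_aux k (Lb # w) = Beta (Suc k) # factor_aux 0 w"
| "factor_aux k (Lc # w) = Gamma (Suc k) # factor_aux 0 w"

definition factor :: "letter list \<Rightarrow> gen list" where
  "factor w = factor_aux 0 w"

definition in_A1 :: "letter list \<Rightarrow> bool" where
  "in_A1 w \<longleftrightarrow> w = [] \<or> last w \<noteq> La"

text \<open>The automorphism exchanging \<open>b\<close> and \<open>c\<close>, on the algebra and on sequences of generators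
  (where it exchanges $\beta_k$ and $\gamma_k$), and the operators $M_x$ on both.\<close>

fun swap_letter :: "letter \<Rightarrow> letter" where
  "swap_letter La = La"
| "swap_letter Lb = Lc"
| "swap_letter Lc = Lb"

definition swap_alg :: "alg \<Rightarrow> alg" where
  "swap_alg = lin_ext (\<lambda>w. monomial (map swap_letter w))"

fun swap_gen :: "gen \<Rightarrow> gen" where
  "swap_gen (Beta k) = Gamma k"
| "swap_gen (Gamma k) = Beta k"

fun M_alg :: "gen \<Rightarrow> alg \<Rightarrow> alg" where
  "M_alg (Beta k) p = p"
| "M_alg (Gamma k) p = swap_alg p"

fun M_gens :: "gen \<Rightarrow> gen list \<Rightarrow> gen list" where
  "M_gens (Beta k) zs = zs"
| "M_gens (Gamma k) zs = map swap_gen zs"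

lemma length_M_gens [simp]: "length (M_gens x zs) = length zs"
  by (cases x) simp_all

fun gen_bracket :: "gen \<Rightarrow> gen \<Rightarrow> gen" where
  "gen_bracket (Beta m) (Beta n) = Beta (m + n)"
| "gen_bracket (Gamma m) (Gamma n) = Beta (m + n)"
| "gen_bracket (Beta m) (Gamma n) = Gamma (m + n)"
| "gen_bracket (Gamma m) (Beta n) = Gamma (m + n)"

function stuffle_gens :: "gen list \<Rightarrow> gen list \<Rightarrow> alg" where
  "stuffle_gens [] vs = monomial (gens_word vs)"
| "stuffle_gens (x # us) [] = monomial (gens_word (x # us))"
| "stuffle_gens (x # us) (y # vs) =
     monomial (gen_word x) * M_alg x (stuffle_gens (M_gens x us) (y # vs))
   + monomial (gen_word y) * M_alg y (stuffle_gens (x # us) (M_gens y vs))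
   + monomial (gen_word (gen_bracket x y)) *
       M_alg (gen_bracket x y) (stuffle_gens (M_gens x us) (M_gens y vs))"
  by pat_completeness auto
termination
  by (relation "measure (\<lambda>(us, vs). length us + length vs)") simp_all

definition stuffle :: "alg \<Rightarrow> alg \<Rightarrow> alg" where
  "stuffle = bilin_ext (\<lambda>u v. stuffle_gens (factor u) (factor v))"

text \<open>The defining equations of the stuffle product, in terms of words not ending in \<open>a\<close>.\<close>

lemma factor_gen_word:
  "gen_index x \<ge> 1 \<Longrightarrow> factor (gen_word x @ w) = x # factor w"
proof -
  have *: "factor_aux k (replicate m La @ w) = factor_aux (m + k) w" for m k w
    by (induction m arbitrary: k) simp_all
  show "gen_index x \<ge> 1 \<Longrightarrow> factor (gen_word x @ w) = x # factor w"
    by (cases x) (simp_all add: factor_def *)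
qed

lemma gens_word_factor: "in_A1 w \<Longrightarrow> gens_word (factor w) = w"
proof -
  have "replicate k La @ w = gens_word (factor_aux k w)" if "w \<noteq> []" "last w \<noteq> La" for k
    using that
  proof (induction k w rule: factor_aux.induct)
    case (2 k w)
    then have "replicate (Suc k) La @ w = gens_word (factor_aux (Suc k) w)"
      by (cases "w = []") auto
    then show ?case
      by (simp add: replicate_app_Cons_same)
  next
    case (3 k w)
    then show ?case
      by (cases "w = []") (auto simp: gens_word_def)
  next
    case (4 k w)
    then show ?case
      by (cases "w = []") (auto simp: gens_word_def)
  qed simp
  from this[of 0] show "in_A1 w \<Longrightarrow> gens_word (factor w) = w"
    by (cases "w = []") (auto simp: in_A1_def factor_def gens_word_def)
qed

lemma factor_swap: "factor (map swap_letter w) = map swap_gen (factor w)"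
proof -
  have "factor_aux k (map swap_letter w) = map swap_gen (factor_aux k w)" for k
    by (induction k w rule: factor_aux.induct) simp_all
  then show ?thesis
    by (simp add: factor_def)
qed

lemma stuffle_one_left: "in_A1 w \<Longrightarrow> stuffle 1 (monomial w) = monomial w"
  by (simp add: stuffle_def bilin_ext_mono gens_word_factor factor_def[of "[]"] flip: monomial_Nil)

lemma stuffle_one_right: "in_A1 w \<Longrightarrow> stuffle (monomial w) 1 = monomial w"
proof -
  have "stuffle_gens zs [] = monomial (gens_word zs)" for zs
    by (cases zs) simp_all
  then show "in_A1 w \<Longrightarrow> stuffle (monomial w) 1 = monomial w"
    by (simp add: stuffle_def bilin_ext_mono gens_word_factor factor_def[of "[]"] flip: monomial_Nil)
qed

lemma stuffle_rec:
  assumes "gen_index x \<ge> 1" "gen_index y \<ge> 1"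
  defines "p \<equiv> monomial (gen_word x)" and "q \<equiv> monomial (gen_word y)"
    and "r \<equiv> monomial (gen_word (gen_bracket x y))"
  shows "stuffle (p * monomial u) (q * monomial v) =
      p * M_alg x (stuffle (M_alg x (monomial u)) (q * monomial v))
    + q * M_alg y (stuffle (p * monomial u) (M_alg y (monomial v)))
    + r * M_alg (gen_bracket x y) (stuffle (M_alg x (monomial u)) (M_alg y (monomial v)))"
proof -
  have M: "\<exists>w'. M_alg z (monomial w) = monomial w' \<and> factor w' = M_gens z (factor w)" for z w
    by (cases z) (auto simp: swap_alg_def lin_ext_mono factor_swap)
  obtain u' where u': "M_alg x (monomial u) = monomial u'" "factor u' = M_gens x (factor u)"
    using M by blast
  obtain v' where v': "M_alg y (monomial v) = monomial v'" "factor v' = M_gens y (factor v)"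
    using M by blast
  show ?thesis
    unfolding p_def q_def r_def u' v' monomial_append[symmetric] stuffle_def bilin_ext_mono
    using assms(1,2) by (simp add: factor_gen_word u' v')
qed


section \<open>Star-concatenation\<close>

definition star_word :: "letter list \<Rightarrow> letter list \<Rightarrow> letter list" where
  "star_word u v =
     (if u \<noteq> [] \<and> v \<noteq> [] \<and> last u = Lb \<and> hd v = Lb then u @ Lc # tl v
      else if u \<noteq> [] \<and> v \<noteq> [] \<and> last u = Lc \<and> hd v = Lc then u @ Lb # tl v
      else u @ v)"

definition star :: "alg \<Rightarrow> alg \<Rightarrow> alg" where
  "star = bilin_ext (\<lambda>u v. monomial (star_word u v))"

text \<open>Evaluated from left to right; the initial \<open>1\<close> is neutral for \<^const>\<open>star\<close>.\<close>

definition star_list :: "alg list \<Rightarrow> alg" where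
  "star_list ps = foldl star 1 ps"


section \<open>The elements of the identity\<close>

definition xd :: alg where
  "xd = xa * (xb + xc)"

definition block :: "nat \<Rightarrow> alg" where
  "block j = (if odd j then xc else xd)"

definition S_elem :: "nat \<Rightarrow> nat \<Rightarrow> alg" where
  "S_elem n i = star_list (map block [i + 1..<2 * n + 1])"

definition P_elem :: "nat \<Rightarrow> alg" where
  "P_elem i = (if odd i then star_list (map block [1..<i + 1])
               else star_list (map block (rev [1..<i + 1])))"

definition Delta :: "nat \<Rightarrow> nat \<Rightarrow> alg" where
  "Delta n i = shuffle (P_elem i) (S_elem n i) - stuffle (P_elem i) (S_elem n i)"

end

theory Submission
  imports Defs
begin

text \<open>
  Put $f = d \star c = a(bc+cb)$. Then $P_{2k} = f^k$, $P_{2k+1} = c f^k$,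
  $S_{2k} = c f^{n-k-1} d$ (which is $1$ for $k = n$) and $S_{2k+1} = f^{n-k-1} d$, so the
  alternating sum $F_n$ of the products of $P_i$ and $S_i$ is a difference of two convolutions. The
  sums for the shuffle and the stuffle product are evaluated separately by recursion on $n$.

  Shuffle: expanding by the first, second and third letter, all terms cancel except those beginning
  with $acc$, and $F_{n+1} = -2\,acc\,F'_n$, where $F'_n$ is $F_n$ with $b$ and $c$ exchanged.

  Stuffle: with $N_x(p) = x\,M_x(p)$ the defining recursion becomes the ordinary quasi-shuffle rule
  $N_x p * N_y q = N_x(p * N_y q) + N_y(N_x p * q) + N_{[x,y]}(p * q)$, and the operators of the
  blocks, $N_{\gamma_1}$ and $N_{\beta_2} + N_{\gamma_2}$, build all $P_i$ and $S_i$ from $1$. The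
  first two terms of the rule telescope in the alternating sum, and the third gives
  $F_{n+1} = -(N_{\beta_3} + N_{\gamma_3})F_n = -a^2(b+c) F_n$.
\<close>

section \<open>Linear maps on the free algebra\<close>

lemma alg_induct [case_names zero add_single]:
  assumes "P (0 :: alg)" and "\<And>p w r. P p \<Longrightarrow> P (p + Poly_Mapping.single w r)"
  shows "P p"
proof (induction p rule: update_induct)
  case (update p w r)
  have "Poly_Mapping.update w r p = p + Poly_Mapping.single w r"
    using update(1) by (intro poly_mapping_eqI)
      (auto simp: lookup_update lookup_add lookup_single in_keys_iff when_def)
  with assms(2) update(3) show ?case by simp
qed (rule assms(1))

text \<open>Scalars are encoded as multiples of the empty word. Their centrality makes left
  multiplication by a fixed element linear although the algebra is noncommutative.\<close>

lemma single_zero_commute: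
  fixes p :: alg
  shows "Poly_Mapping.single 0 r * p = p * Poly_Mapping.single 0 r"
  by (induction p rule: alg_induct) (simp_all add: algebra_simps mult_single)

definition alg_linear :: "(alg \<Rightarrow> alg) \<Rightarrow> bool" where
  "alg_linear \<phi> \<longleftrightarrow> (\<forall>p q. \<phi> (p + q) = \<phi> p + \<phi> q) \<and>
     (\<forall>r p. \<phi> (Poly_Mapping.single 0 r * p) = Poly_Mapping.single 0 r * \<phi> p)"

lemma alg_linear_add: "alg_linear \<phi> \<Longrightarrow> \<phi> (p + q) = \<phi> p + \<phi> q"
  by (simp add: alg_linear_def)

lemma alg_linear_0: "alg_linear \<phi> \<Longrightarrow> \<phi> 0 = 0"
  using alg_linear_add[of \<phi> 0 0] by simp

lemma alg_linear_diff: "alg_linear \<phi> \<Longrightarrow> \<phi> (p - q) = \<phi> p - \<phi> q"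
  using alg_linear_add[of \<phi> "p - q" q] by (simp add: algebra_simps)

lemma alg_linear_sum: "alg_linear \<phi> \<Longrightarrow> \<phi> (sum g A) = (\<Sum>i\<in>A. \<phi> (g i))"
  by (induction A rule: infinite_finite_induct) (simp_all add: alg_linear_0 alg_linear_add)

text \<open>Every element is a sum of scalar multiples of words, so linear identities may be checked
  on words. The word recursions of the products are lifted to arbitrary elements this way.\<close>

lemma alg_linear_eqI:
  assumes "alg_linear \<phi>" "alg_linear \<psi>" and "\<And>w. \<phi> (monomial w) = \<psi> (monomial w)"
  shows "\<phi> p = \<psi> p"
proof (induction p rule: alg_induct)
  case zero
  show ?case using assms by (simp add: alg_linear_0)
next
  case (add_single p w r)
  have "Poly_Mapping.single w r = Poly_Mapping.single 0 r * monomial w"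
    by (simp add: monomial_def mult_single)
  with add_single assms show ?case
    by (simp add: alg_linear_def)
qed

lemma alg_linear_eqI2:
  assumes "\<And>q. alg_linear (\<lambda>p. \<phi> p q)" "\<And>p. alg_linear (\<phi> p)"
    and "\<And>q. alg_linear (\<lambda>p. \<psi> p q)" "\<And>p. alg_linear (\<psi> p)"
    and "\<And>u v. \<phi> (monomial u) (monomial v) = \<psi> (monomial u) (monomial v)"
  shows "\<phi> p q = \<psi> p q"
proof -
  have "\<phi> (monomial u) q = \<psi> (monomial u) q" for u q
    by (rule alg_linear_eqI[OF assms(2,4,5)])
  then show ?thesis
    by (rule alg_linear_eqI[OF assms(1,3)])
qed

text \<open>Words outside the support contribute 0. In a sum of two elements words may cancel, so
  additivity of \<open>lin_ext\<close> needs a common index set.\<close>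

lemma lin_ext_superset:
  assumes "finite A" "Poly_Mapping.keys p \<subseteq> A"
  shows "lin_ext f p = (\<Sum>w\<in>A. Poly_Mapping.single 0 (Poly_Mapping.lookup p w) * f w)"
  unfolding lin_ext_def using assms
  by (intro sum.mono_neutral_left) (auto simp: in_keys_iff)

lemma alg_linear_lin_ext: "alg_linear (lin_ext f)"
  unfolding alg_linear_def
proof (intro conjI allI)
  fix p q :: alg
  let ?A = "Poly_Mapping.keys p \<union> Poly_Mapping.keys q"
  have "lin_ext f (p + q) = (\<Sum>w\<in>?A. Poly_Mapping.single 0 (Poly_Mapping.lookup (p + q) w) * f w)"
    by (intro lin_ext_superset) (auto dest: keys_add[THEN subsetD])
  also have "\<dots> = (\<Sum>w\<in>?A. Poly_Mapping.single 0 (Poly_Mapping.lookup p w) * f w)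
      + (\<Sum>w\<in>?A. Poly_Mapping.single 0 (Poly_Mapping.lookup q w) * f w)"
    by (simp add: lookup_add single_add distrib_right sum.distrib)
  also have "\<dots> = lin_ext f p + lin_ext f q"
    by (simp add: lin_ext_superset[of ?A p] lin_ext_superset[of ?A q])
  finally show "lin_ext f (p + q) = lin_ext f p + lin_ext f q" .
next
  fix r :: rat and p :: alg
  have lookup: "Poly_Mapping.lookup (Poly_Mapping.single 0 r * p) w = r * Poly_Mapping.lookup p w" for w
    by (induction p rule: alg_induct)
      (simp_all add: distrib_left mult_single lookup_add lookup_single when_def)
  have "lin_ext f (Poly_Mapping.single 0 r * p) =
      (\<Sum>w\<in>Poly_Mapping.keys p. Poly_Mapping.single 0 (r * Poly_Mapping.lookup p w) * f w)"
    by (subst lin_ext_superset[of "Poly_Mapping.keys p"]) (auto simp: lookup in_keys_iff)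
  also have "\<dots> = (\<Sum>w\<in>Poly_Mapping.keys p.
      Poly_Mapping.single 0 r * (Poly_Mapping.single 0 (Poly_Mapping.lookup p w) * f w))"
    by (simp add: mult_single flip: mult.assoc)
  finally show "lin_ext f (Poly_Mapping.single 0 r * p) = Poly_Mapping.single 0 r * lin_ext f p"
    by (simp add: lin_ext_def sum_distrib_left)
qed

lemma alg_linear_comp: "alg_linear \<phi> \<Longrightarrow> alg_linear \<psi> \<Longrightarrow> alg_linear (\<lambda>p. \<phi> (\<psi> p))"
  by (simp add: alg_linear_def)

lemma alg_linear_plus: "alg_linear \<phi> \<Longrightarrow> alg_linear \<psi> \<Longrightarrow> alg_linear (\<lambda>p. \<phi> p + \<psi> p)"
  by (simp add: alg_linear_def algebra_simps)

lemma alg_linear_mult_left: "alg_linear \<phi> \<Longrightarrow> alg_linear (\<lambda>p. q * \<phi> p)"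
  unfolding alg_linear_def by (metis distrib_left mult.assoc single_zero_commute)

lemma alg_linear_mult_right: "alg_linear \<phi> \<Longrightarrow> alg_linear (\<lambda>p. \<phi> p * q)"
  by (simp add: alg_linear_def algebra_simps)

lemma alg_linear_ident: "alg_linear (\<lambda>p. p)"
  by (simp add: alg_linear_def)

lemma alg_linear_bilin_ext_right: "alg_linear \<phi> \<Longrightarrow> alg_linear (\<lambda>q. bilin_ext f p (\<phi> q))"
proof -
  have "alg_linear (bilin_ext f p)"
    unfolding alg_linear_def bilin_ext_def
  proof (intro conjI allI)
    fix q r :: alg
    show "lin_ext (\<lambda>u. lin_ext (f u) (q + r)) p =
        lin_ext (\<lambda>u. lin_ext (f u) q) p + lin_ext (\<lambda>u. lin_ext (f u) r) p"
      by (simp add: alg_linear_add[OF alg_linear_lin_ext] lin_ext_def[of _ p] distrib_left sum.distrib)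
  next
    fix r :: rat and q :: alg
    have "lin_ext (f u) (Poly_Mapping.single 0 r * q) = Poly_Mapping.single 0 r * lin_ext (f u) q" for u
      using alg_linear_lin_ext[of "f u"] by (simp add: alg_linear_def)
    then show "lin_ext (\<lambda>u. lin_ext (f u) (Poly_Mapping.single 0 r * q)) p =
        Poly_Mapping.single 0 r * lin_ext (\<lambda>u. lin_ext (f u) q) p"
      by (simp add: lin_ext_def[of _ p] sum_distrib_left mult_single mult.commute[of r] flip: mult.assoc)
  qed
  then show "alg_linear \<phi> \<Longrightarrow> alg_linear (\<lambda>q. bilin_ext f p (\<phi> q))"
    by (rule alg_linear_comp)
qed

lemma alg_linear_bilin_ext_left: "alg_linear \<phi> \<Longrightarrow> alg_linear (\<lambda>p. bilin_ext f (\<phi> p) q)"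
  unfolding bilin_ext_def by (rule alg_linear_comp[OF alg_linear_lin_ext])

lemma alg_linear_shuffle:
  "alg_linear \<phi> \<Longrightarrow> alg_linear (\<lambda>p. shuffle (\<phi> p) q)"
  "alg_linear \<phi> \<Longrightarrow> alg_linear (\<lambda>p. shuffle q (\<phi> p))"
  by (simp_all add: shuffle_def alg_linear_bilin_ext_left alg_linear_bilin_ext_right)

lemma alg_linear_stuffle:
  "alg_linear \<phi> \<Longrightarrow> alg_linear (\<lambda>p. stuffle (\<phi> p) q)"
  "alg_linear \<phi> \<Longrightarrow> alg_linear (\<lambda>p. stuffle q (\<phi> p))"
  by (simp_all add: stuffle_def alg_linear_bilin_ext_left alg_linear_bilin_ext_right)

lemma alg_linear_star:
  "alg_linear \<phi> \<Longrightarrow> alg_linear (\<lambda>p. star (\<phi> p) q)"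
  "alg_linear \<phi> \<Longrightarrow> alg_linear (\<lambda>p. star q (\<phi> p))"
  by (simp_all add: star_def alg_linear_bilin_ext_left alg_linear_bilin_ext_right)

lemma alg_linear_swap: "alg_linear \<phi> \<Longrightarrow> alg_linear (\<lambda>p. swap_alg (\<phi> p))"
  unfolding swap_alg_def by (rule alg_linear_comp[OF alg_linear_lin_ext])

lemma alg_linear_M_alg: "alg_linear \<phi> \<Longrightarrow> alg_linear (\<lambda>p. M_alg x (\<phi> p))"
  by (cases x) (simp_all add: alg_linear_swap)

text \<open>The rules carry an inner linear map, so that linearity of nested expressions follows by
  backward chaining.\<close>

lemmas alg_linear_intros = alg_linear_ident alg_linear_plus alg_linear_mult_left
  alg_linear_mult_right alg_linear_shuffle alg_linear_stuffle alg_linear_star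
  alg_linear_swap alg_linear_M_alg

lemmas shuffle_add = alg_linear_shuffle[OF alg_linear_ident, THEN alg_linear_add]
lemmas stuffle_add = alg_linear_stuffle[OF alg_linear_ident, THEN alg_linear_add]
lemmas star_add = alg_linear_star[OF alg_linear_ident, THEN alg_linear_add]
lemmas swap_alg_add = alg_linear_swap[OF alg_linear_ident, THEN alg_linear_add]

section \<open>The products on algebra elements\<close>

lemma shuffle_one_left: "shuffle 1 p = p"
proof (rule alg_linear_eqI[of "shuffle 1"])
  show "shuffle 1 (monomial w) = monomial w" for w
    by (simp add: shuffle_def bilin_ext_mono flip: monomial_Nil)
qed (intro alg_linear_intros)+

lemma shuffle_one_right: "shuffle p 1 = p"
proof (rule alg_linear_eqI[of "\<lambda>p. shuffle p 1"])
  show "shuffle (monomial w) 1 = monomial w" for w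
    by (cases w) (simp_all add: shuffle_def bilin_ext_mono flip: monomial_Nil)
qed (auto intro!: alg_linear_intros)

lemma shuffle_letters:
  "shuffle (monomial [x] * p) (monomial [y] * q) =
     monomial [x] * shuffle p (monomial [y] * q) + monomial [y] * shuffle (monomial [x] * p) q"
proof (rule alg_linear_eqI2[of "\<lambda>p q. shuffle (monomial [x] * p) (monomial [y] * q)"])
  fix u v
  show "shuffle (monomial [x] * monomial u) (monomial [y] * monomial v) =
     monomial [x] * shuffle (monomial u) (monomial [y] * monomial v)
     + monomial [y] * shuffle (monomial [x] * monomial u) (monomial v)"
    by (simp add: shuffle_def bilin_ext_mono flip: monomial_append)
qed (intro alg_linear_intros)+

lemma swap_alg_monomial: "swap_alg (monomial w) = monomial (map swap_letter w)"
  by (simp add: swap_alg_def lin_ext_mono)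

lemma swap_alg_mult: "swap_alg (p * q) = swap_alg p * swap_alg q"
  by (rule alg_linear_eqI2[of "\<lambda>p q. swap_alg (p * q)"])
    (auto intro!: alg_linear_intros simp: swap_alg_monomial simp flip: monomial_append)

lemma swap_alg_one: "swap_alg 1 = 1"
  by (simp add: swap_alg_monomial flip: monomial_Nil)

lemma swap_alg_power: "swap_alg (p ^ k) = swap_alg p ^ k"
  by (induction k) (simp_all add: swap_alg_one swap_alg_mult)

lemma swap_alg_letters: "swap_alg xa = xa" "swap_alg xb = xc" "swap_alg xc = xb"
  by (simp_all add: xa_def xb_def xc_def swap_alg_monomial)

section \<open>The operators N_x (\<open>gen_cons\<close>) and the quasi-shuffle rule\<close>

definition gen_cons :: "gen \<Rightarrow> alg \<Rightarrow> alg" where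
  "gen_cons x p = monomial (gen_word x) * M_alg x p"

definition gen_cons_word :: "gen \<Rightarrow> letter list \<Rightarrow> letter list" where
  "gen_cons_word x w = gen_word x @ (case x of Beta _ \<Rightarrow> w | Gamma _ \<Rightarrow> map swap_letter w)"

lemma alg_linear_gen_cons: "alg_linear \<phi> \<Longrightarrow> alg_linear (\<lambda>p. gen_cons x (\<phi> p))"
  unfolding gen_cons_def by (intro alg_linear_intros)

lemma gen_cons_monomial: "gen_cons x (monomial w) = monomial (gen_cons_word x w)"
  by (cases x) (simp_all add: gen_cons_def gen_cons_word_def swap_alg_monomial flip: monomial_append)

lemma factor_gen_cons_word:
  "gen_index x \<ge> 1 \<Longrightarrow> factor (gen_cons_word x w) = x # M_gens x (factor w)"
  unfolding gen_cons_word_def by (subst factor_gen_word) (cases x; simp add: factor_swap)+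

lemma M_gens_M_gens: "M_gens x (M_gens x us) = us"
proof -
  have "swap_gen (swap_gen y) = y" for y
    by (cases y) simp_all
  then show ?thesis
    by (cases x) (simp_all add: comp_def)
qed

lemma gens_word_swap: "gens_word (map swap_gen us) = map swap_letter (gens_word us)"
proof -
  have "gen_word (swap_gen y) = map swap_letter (gen_word y)" for y
    by (cases y) (simp_all add: map_replicate_const)
  then show ?thesis
    by (induction us) (simp_all add: gens_word_def)
qed

lemma gens_word_gen_cons: "gens_word (x # M_gens x us) = gen_cons_word x (gens_word us)"
proof -
  have "gens_word (x # vs) = gen_word x @ gens_word vs" for vs
    by (simp add: gens_word_def)
  then show ?thesis
    by (cases x) (simp_all add: gens_word_swap gen_cons_word_def)
qed

text \<open>The recursion applies M_x to the tail of N_x p, which is already M_x p; as M_x is an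
  involution, p itself is left. Since \<open>factor\<close> commutes with the exchange of b and c on
  all words, no restriction to words outside a's right multiples is required.\<close>

lemma stuffle_gen_cons:
  assumes "gen_index x \<ge> 1" "gen_index y \<ge> 1"
  shows "stuffle (gen_cons x p) (gen_cons y q) = gen_cons x (stuffle p (gen_cons y q))
    + gen_cons y (stuffle (gen_cons x p) q) + gen_cons (gen_bracket x y) (stuffle p q)"
proof (rule alg_linear_eqI2[of "\<lambda>p q. stuffle (gen_cons x p) (gen_cons y q)"])
  fix u v
  show "stuffle (gen_cons x (monomial u)) (gen_cons y (monomial v)) =
      gen_cons x (stuffle (monomial u) (gen_cons y (monomial v)))
    + gen_cons y (stuffle (gen_cons x (monomial u)) (monomial v))
    + gen_cons (gen_bracket x y) (stuffle (monomial u) (monomial v))"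
    using assms by (simp add: gen_cons_monomial stuffle_def bilin_ext_mono factor_gen_cons_word
        M_gens_M_gens) (simp add: gen_cons_def)
qed (intro alg_linear_intros alg_linear_gen_cons)+

text \<open>For words ending in a, \<open>stuffle 1\<close> is not the identity, because
  \<open>factor\<close> drops the trailing a's. Commutation with N_x still holds for every
  p.\<close>

lemma stuffle_one_gen_cons:
  assumes "gen_index x \<ge> 1"
  shows "stuffle 1 (gen_cons x p) = gen_cons x (stuffle 1 p)"
    and "stuffle (gen_cons x p) 1 = gen_cons x (stuffle p 1)"
proof -
  have right: "stuffle_gens us [] = monomial (gens_word us)" for us
    by (cases us) simp_all
  have factor_Nil: "factor [] = []"
    by (simp add: factor_def)
  show "stuffle 1 (gen_cons x p) = gen_cons x (stuffle 1 p)"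
  proof (rule alg_linear_eqI[of "\<lambda>p. stuffle 1 (gen_cons x p)"])
    show "stuffle 1 (gen_cons x (monomial w)) = gen_cons x (stuffle 1 (monomial w))" for w
      using assms by (simp add: gen_cons_monomial stuffle_def bilin_ext_mono factor_gen_cons_word
          factor_Nil gens_word_gen_cons flip: monomial_Nil)
  qed (intro alg_linear_intros alg_linear_gen_cons)+
  show "stuffle (gen_cons x p) 1 = gen_cons x (stuffle p 1)"
  proof (rule alg_linear_eqI[of "\<lambda>p. stuffle (gen_cons x p) 1"])
    show "stuffle (gen_cons x (monomial w)) 1 = gen_cons x (stuffle (monomial w) 1)" for w
      using assms by (simp add: gen_cons_monomial stuffle_def bilin_ext_mono factor_gen_cons_word
          factor_Nil right gens_word_gen_cons flip: monomial_Nil)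
  qed (intro alg_linear_intros alg_linear_gen_cons)+
qed

section \<open>Convolutions of sequences\<close>

text \<open>The argument n counts the summands, whose indices add up to n - 1; thus n = 0 is the
  empty sum, which starts the recursions.\<close>

definition conv :: "(alg \<Rightarrow> alg \<Rightarrow> alg) \<Rightarrow> (nat \<Rightarrow> alg) \<Rightarrow> (nat \<Rightarrow> alg) \<Rightarrow> nat \<Rightarrow> alg" where
  "conv prd p q n = (\<Sum>k<n. prd (p k) (q (n - Suc k)))"

text \<open>X collects terms opened by the left factor, Y those opened by the right one, and Z the
  bracket terms. At each end one factor is 1, so only one kind of term occurs there; shifting the
  index completes both sums.\<close>

lemma sum_split_ends:
  fixes t X Y Z :: "nat \<Rightarrow> alg"
  assumes "t 0 = Y 0" "t (Suc m) = X m" "\<And>k. k < m \<Longrightarrow> t (Suc k) = X k + Y (Suc k) + Z k"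
  shows "(\<Sum>k<Suc (Suc m). t k) = (\<Sum>k<Suc m. X k) + (\<Sum>k<Suc m. Y k) + (\<Sum>k<m. Z k)"
proof -
  have "(\<Sum>k<Suc (Suc m). t k) = Y 0 + (\<Sum>k<m. X k + Y (Suc k) + Z k) + X m"
    using assms by (subst sum.lessThan_Suc_shift) (simp add: add.assoc)
  also have "(\<Sum>k<m. X k + Y (Suc k) + Z k) = (\<Sum>k<m. X k) + (\<Sum>k<m. Y (Suc k)) + (\<Sum>k<m. Z k)"
    by (simp add: sum.distrib)
  also have "Y 0 + ((\<Sum>k<m. X k) + (\<Sum>k<m. Y (Suc k)) + (\<Sum>k<m. Z k)) + X m =
      (\<Sum>k<Suc m. X k) + (Y 0 + (\<Sum>k<m. Y (Suc k))) + (\<Sum>k<m. Z k)"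
    by (simp add: algebra_simps)
  also have "Y 0 + (\<Sum>k<m. Y (Suc k)) = (\<Sum>k<Suc m. Y k)"
    by (rule sum.lessThan_Suc_shift[symmetric])
  finally show ?thesis .
qed

lemma conv_shuffle_letters:
  "conv shuffle (\<lambda>k. monomial [x] * p k) (\<lambda>k. monomial [y] * q k) n =
     monomial [x] * conv shuffle p (\<lambda>k. monomial [y] * q k) n
     + monomial [y] * conv shuffle (\<lambda>k. monomial [x] * p k) q n"
  by (simp add: conv_def shuffle_letters sum.distrib sum_distrib_left)

text \<open>The summand with \<open>q 0 = 1\<close> yields an x-term only, so the y-convolution is
  one summand shorter.\<close>

lemma conv_shuffle_letter_unital:
  assumes "q 0 = 1" "\<And>k. q (Suc k) = monomial [y] * q' k"
  shows "conv shuffle (\<lambda>k. monomial [x] * p k) q (Suc n) =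
     monomial [x] * conv shuffle p q (Suc n)
     + monomial [y] * conv shuffle (\<lambda>k. monomial [x] * p k) q' n"
proof -
  have "shuffle (monomial [x] * p k) (q (n - k)) = monomial [x] * shuffle (p k) (q (n - k))
      + monomial [y] * shuffle (monomial [x] * p k) (q' (n - Suc k))" if "k < n" for k
    using that assms(2)[of "n - Suc k"] by (simp add: shuffle_letters Suc_diff_Suc)
  then show ?thesis
    by (simp add: conv_def assms(1) shuffle_one_right sum.distrib sum_distrib_left distrib_left
        add.assoc add.commute add.left_commute)
qed

lemma conv_shuffle_unital_letter:
  assumes "p 0 = 1" "\<And>k. p (Suc k) = monomial [x] * p' k"
  shows "conv shuffle p (\<lambda>k. monomial [y] * q k) (Suc n) =
     monomial [x] * conv shuffle p' (\<lambda>k. monomial [y] * q k) n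
     + monomial [y] * conv shuffle p q (Suc n)"
  unfolding conv_def sum.lessThan_Suc_shift
  by (simp add: assms shuffle_one_left shuffle_letters sum.distrib sum_distrib_left distrib_left
      add.assoc add.commute add.left_commute)

lemma conv_shuffle_unital:
  assumes "p 0 = 1" "\<And>k. p (Suc k) = monomial [x] * p' k"
    and "q 0 = 1" "\<And>k. q (Suc k) = monomial [y] * q' k"
  shows "conv shuffle p q (Suc (Suc n)) =
     monomial [x] * conv shuffle p' q (Suc n) + monomial [y] * conv shuffle p q' (Suc n)"
proof -
  have "shuffle (p (Suc k)) (q (n - k)) = monomial [x] * shuffle (p' k) (q (n - k))
      + monomial [y] * shuffle (p (Suc k)) (q' (n - Suc k)) + 0" if "k < n" for k
    using that assms(4)[of "n - Suc k"] by (simp add: assms(2) shuffle_letters Suc_diff_Suc)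
  then have "conv shuffle p q (Suc (Suc n)) = (\<Sum>k<Suc n. monomial [x] * shuffle (p' k) (q (n - k)))
      + (\<Sum>k<Suc n. monomial [y] * shuffle (p k) (q' (n - k))) + (\<Sum>k<n. 0)"
    unfolding conv_def
    by (intro sum_split_ends) (simp_all add: assms shuffle_one_left shuffle_one_right)
  then show ?thesis
    unfolding conv_def by (simp only: sum_distrib_left diff_Suc_Suc sum.neutral_const add_0_right)
qed

lemma conv_add:
  assumes "\<And>p q r. prd (p + q) r = prd p r + prd q r" "\<And>p q r. prd r (p + q) = prd r p + prd r q"
  shows "conv prd (\<lambda>k. p k + q k) r n = conv prd p r n + conv prd q r n"
    "conv prd r (\<lambda>k. p k + q k) n = conv prd r p n + conv prd r q n"
  by (simp_all add: conv_def assms sum.distrib)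

lemmas conv_shuffle_add = conv_add[of shuffle, OF shuffle_add]

section \<open>The shuffle part\<close>

text \<open>In the application A k is f^k, g k is f^k d, and U, W are 1 at index 0 and then c f^k d,
  b f^k d. Stripping three letters leads from U to W, hence to the sum with b and c
  exchanged.\<close>

lemma conv_shuffle_reduction:
  fixes x y z :: letter and A U W g :: "nat \<Rightarrow> alg"
  defines "a \<equiv> monomial [x]" and "b \<equiv> monomial [y]" and "c \<equiv> monomial [z]"
  assumes A: "A 0 = 1" "\<And>k. A (Suc k) = a * (b * (c * A k) + c * (b * A k))"
    and U: "U 0 = 1" "\<And>k. U (Suc k) = c * g k"
    and W: "W 0 = 1" "\<And>k. W (Suc k) = b * g k"
    and g: "\<And>k. g k = a * (b * U k + c * W k)"
  shows "conv shuffle A U (Suc (Suc m)) - conv shuffle (\<lambda>k. c * A k) g (Suc m) =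
    - 2 * (a * c * c * (conv shuffle A W (Suc m) - conv shuffle (\<lambda>k. b * A k) g m))"
proof -
  define T where "T k = b * U k + c * W k" for k
  define B where "B k = b * (c * A k) + c * (b * A k)" for k
  have g': "g = (\<lambda>k. a * T k)"
    by (simp add: fun_eq_iff g T_def)
  have A': "A (Suc k) = a * B k" for k
    by (simp add: A B_def)
  have B_left: "conv shuffle B q n =
      conv shuffle (\<lambda>k. b * (c * A k)) q n + conv shuffle (\<lambda>k. c * (b * A k)) q n" for q n
    unfolding B_def by (rule conv_shuffle_add)
  have T_right: "conv shuffle p T n =
      conv shuffle p (\<lambda>k. b * U k) n + conv shuffle p (\<lambda>k. c * W k) n" for p n
    unfolding T_def by (rule conv_shuffle_add)
  have letters: "conv shuffle (\<lambda>k. monomial [l] * p k) g n =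
      monomial [l] * conv shuffle p g n + a * conv shuffle (\<lambda>k. monomial [l] * p k) T n" for l p n
    unfolding g' a_def by (rule conv_shuffle_letters)
  \<comment> \<open>The convolution of B with T can be split on the left or on the right. Equating
    both splittings cancels the terms whose third letter is a.\<close>
  have BT: "conv shuffle B (\<lambda>k. b * U k) m = conv shuffle (\<lambda>k. b * (c * A k)) T m
      + conv shuffle (\<lambda>k. c * (b * A k)) T m - conv shuffle B (\<lambda>k. c * W k) m"
    using B_left[of T m] T_right[of B m] by (simp add: algebra_simps)
  note AU = conv_shuffle_unital[OF A(1) A'[unfolded a_def] U[unfolded c_def], folded a_def c_def]
  note AbU = conv_shuffle_unital_letter[OF A(1) A'[unfolded a_def], of y, folded a_def b_def]
  note AcW = conv_shuffle_unital_letter[OF A(1) A'[unfolded a_def], of z, folded a_def c_def]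
  note bU = conv_shuffle_letter_unital[OF U[unfolded c_def], of y, folded b_def c_def]
  note cU = conv_shuffle_letter_unital[OF U[unfolded c_def], of z, folded b_def c_def]
  note cW = conv_shuffle_letter_unital[OF W[unfolded b_def], of z, folded b_def c_def]
  note bc = conv_shuffle_letters[of z _ y, folded b_def c_def]
  note cc = conv_shuffle_letters[of z _ z, folded b_def c_def]
  have gg: "conv shuffle (\<lambda>k. b * (c * A k)) g m =
      b * conv shuffle (\<lambda>k. c * A k) g m + a * conv shuffle (\<lambda>k. b * (c * A k)) T m"
    "conv shuffle (\<lambda>k. c * (b * A k)) g m =
      c * conv shuffle (\<lambda>k. b * A k) g m + a * conv shuffle (\<lambda>k. c * (b * A k)) T m"
    "conv shuffle (\<lambda>k. c * A k) g (Suc m) =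
      c * conv shuffle A g (Suc m) + a * conv shuffle (\<lambda>k. c * A k) T (Suc m)"
    unfolding b_def c_def by (rule letters)+
  \<comment> \<open>Once the terms with first letter c cancel, the difference is a times that of the
    next two convolutions, expanded here by the second letter.\<close>
  have BU: "conv shuffle B U (Suc m) =
      b * conv shuffle (\<lambda>k. c * A k) U (Suc m) + c * conv shuffle (\<lambda>k. b * (c * A k)) g m
      + c * conv shuffle (\<lambda>k. b * A k) U (Suc m) + c * conv shuffle (\<lambda>k. c * (b * A k)) g m"
    by (simp add: B_left bU[of "\<lambda>k. c * A k"] cU[of "\<lambda>k. b * A k"] add.assoc)
  have cT: "conv shuffle (\<lambda>k. c * A k) T (Suc m) =
      c * conv shuffle A (\<lambda>k. b * U k) (Suc m) + b * conv shuffle (\<lambda>k. c * A k) U (Suc m)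
      + c * conv shuffle A (\<lambda>k. c * W k) (Suc m) + c * conv shuffle (\<lambda>k. c * A k) W (Suc m)"
    by (simp add: T_right bc[of A U] cc[of A W] add.assoc)
  \<comment> \<open>The terms with second letter b cancel, and so do those with third letter b or,
    by \<open>BT\<close>, a. Each surviving acc-term occurs twice, whence the factor 2.\<close>
  show ?thesis
    unfolding AU gg BU cT AbU[of U] AcW[of W] bU[of A] cW[of A] BT
    by (simp add: algebra_simps mult_2)
qed

section \<open>The stuffle part\<close>

definition cons_c :: "alg \<Rightarrow> alg" where
  "cons_c p = gen_cons (Gamma 1) p"

definition cons_d :: "alg \<Rightarrow> alg" where
  "cons_d p = gen_cons (Beta 2) p + gen_cons (Gamma 2) p"

text \<open>The brackets of gamma_1 with beta_2 and gamma_2 are gamma_3 and beta_3, so this operator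
  is the bracket term of \<open>cons_c\<close> with \<open>cons_d\<close>.\<close>

definition cons_e :: "alg \<Rightarrow> alg" where
  "cons_e p = gen_cons (Beta 3) p + gen_cons (Gamma 3) p"

lemma alg_linear_cons: "alg_linear cons_c" "alg_linear cons_d" "alg_linear cons_e"
  unfolding cons_c_def[abs_def] cons_d_def[abs_def] cons_e_def[abs_def]
  by (intro alg_linear_intros alg_linear_gen_cons)+

lemmas cons_sum = alg_linear_cons[THEN alg_linear_sum]
lemmas gen_cons_add = alg_linear_gen_cons[OF alg_linear_ident, THEN alg_linear_add]

lemma stuffle_cons_c_cons_d:
  "stuffle (cons_c p) (cons_d q) =
     cons_c (stuffle p (cons_d q)) + cons_d (stuffle (cons_c p) q) + cons_e (stuffle p q)"
  by (simp add: cons_c_def cons_d_def cons_e_def stuffle_add stuffle_gen_cons gen_cons_add algebra_simps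
      numeral_3_eq_3)

lemma stuffle_cons_d_cons_c:
  "stuffle (cons_d p) (cons_c q) =
     cons_d (stuffle p (cons_c q)) + cons_c (stuffle (cons_d p) q) + cons_e (stuffle p q)"
  by (simp add: cons_c_def cons_d_def cons_e_def stuffle_add stuffle_gen_cons gen_cons_add algebra_simps
      numeral_3_eq_3)

lemma stuffle_one_cons:
  "stuffle 1 (cons_c p) = cons_c (stuffle 1 p)"
  "stuffle (cons_d p) 1 = cons_d (stuffle p 1)"
  by (simp_all add: cons_c_def cons_d_def stuffle_add stuffle_one_gen_cons)

text \<open>Both convolutions have the same \<open>cons_c\<close> and \<open>cons_d\<close> parts,
  which cancel. The bracket parts strip one block from each factor and thereby exchange the two
  convolutions, which gives the minus sign.\<close>

lemma conv_stuffle_reduction: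
  assumes A: "A 0 = 1" "\<And>k. A (Suc k) = cons_d (cons_c (A k))"
    and U: "U 0 = 1" "\<And>k. U (Suc k) = cons_c (g k)"
    and g: "\<And>k. g k = cons_d (U k)"
  shows "conv stuffle A U (Suc (Suc m)) - conv stuffle (\<lambda>k. cons_c (A k)) g (Suc m) =
    - cons_e (conv stuffle A U (Suc m) - conv stuffle (\<lambda>k. cons_c (A k)) g m)"
proof -
  have "stuffle (A (Suc k)) (U (m - k)) = cons_d (stuffle (cons_c (A k)) (U (m - k)))
      + cons_c (stuffle (A (Suc k)) (g (m - Suc k)))
      + cons_e (stuffle (cons_c (A k)) (g (m - Suc k)))" if "k < m" for k
    using that U(2)[of "m - Suc k"] by (simp add: A(2) stuffle_cons_d_cons_c Suc_diff_Suc)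
  then have "conv stuffle A U (Suc (Suc m)) =
      (\<Sum>k<Suc m. cons_d (stuffle (cons_c (A k)) (U (m - k))))
      + (\<Sum>k<Suc m. cons_c (stuffle (A k) (g (m - k))))
      + (\<Sum>k<m. cons_e (stuffle (cons_c (A k)) (g (m - Suc k))))"
    unfolding conv_def
    by (intro sum_split_ends) (simp_all add: A U stuffle_one_cons)
  then have AU: "conv stuffle A U (Suc (Suc m)) =
      cons_d (conv stuffle (\<lambda>k. cons_c (A k)) U (Suc m)) + cons_c (conv stuffle A g (Suc m))
      + cons_e (conv stuffle (\<lambda>k. cons_c (A k)) g m)"
    unfolding conv_def by (simp only: cons_sum diff_Suc_Suc)
  \<comment> \<open>Here no factor is a bare 1: every summand starts with both operators, so the
    rule applies throughout without end terms.\<close>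
  have "conv stuffle (\<lambda>k. cons_c (A k)) g (Suc m) =
      cons_c (conv stuffle A g (Suc m)) + cons_d (conv stuffle (\<lambda>k. cons_c (A k)) U (Suc m))
      + cons_e (conv stuffle A U (Suc m))"
    unfolding conv_def cons_sum g stuffle_cons_c_cons_d sum.distrib ..
  with AU show ?thesis
    by (simp add: alg_linear_diff[OF alg_linear_cons(3)])
qed

section \<open>Evaluation of the alternating sums\<close>

text \<open>For $y = b$, $z = c$ these are $f$, $f^k d$ and $c f^{k-1} d$ (with value $1$ at $k = 0$). The
  letters are parameters because the shuffle recursion exchanges them.\<close>

definition dc_block :: "letter \<Rightarrow> letter \<Rightarrow> alg" where
  "dc_block y z = xa * (monomial [y] * monomial [z] + monomial [z] * monomial [y])"

definition dc_d :: "letter \<Rightarrow> letter \<Rightarrow> nat \<Rightarrow> alg" where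
  "dc_d y z k = dc_block y z ^ k * (xa * (monomial [y] + monomial [z]))"

fun cd_power :: "letter \<Rightarrow> letter \<Rightarrow> nat \<Rightarrow> alg" where
  "cd_power y z 0 = 1"
| "cd_power y z (Suc k) = monomial [z] * dc_d y z k"

text \<open>This is F_n of the overview: n + 1 summands from even i = 2k, minus n summands from odd
  i = 2k + 1.\<close>

definition alternating :: "(alg \<Rightarrow> alg \<Rightarrow> alg) \<Rightarrow> letter \<Rightarrow> letter \<Rightarrow> nat \<Rightarrow> alg" where
  "alternating prd y z n = conv prd (\<lambda>k. dc_block y z ^ k) (cd_power y z) (Suc n)
     - conv prd (\<lambda>k. monomial [z] * dc_block y z ^ k) (dc_d y z) n"

lemma dc_block_commute: "dc_block y z = dc_block z y"
  by (simp add: dc_block_def add.commute)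

lemma dc_d_commute: "dc_d y z = dc_d z y"
  by (simp add: dc_d_def fun_eq_iff add.commute dc_block_commute)

text \<open>After the leading a, the first block f splits by its next letter. What follows that
  letter starts with the other one, hence the exchanged arguments; for k = 0 the formula is just
  d.\<close>

lemma dc_d_rec: "dc_d y z k = xa * (monomial [y] * cd_power y z k + monomial [z] * cd_power z y k)"
proof (cases k)
  case 0
  then show ?thesis by (simp add: dc_d_def)
next
  case (Suc j)
  have "dc_d y z (Suc j) = dc_block y z * dc_d y z j"
    by (simp add: dc_d_def mult.assoc)
  with Suc show ?thesis
    by (simp add: dc_block_def distrib_right distrib_left mult.assoc dc_d_commute[of z y])
qed

lemma alternating_shuffle_Suc:
  "alternating shuffle y z (Suc m) =
     - 2 * (xa * monomial [z] * monomial [z] * alternating shuffle z y m)"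
proof -
  have "alternating shuffle y z (Suc m) = - 2 * (monomial [La] * monomial [z] * monomial [z] *
      (conv shuffle (\<lambda>k. dc_block y z ^ k) (cd_power z y) (Suc m)
       - conv shuffle (\<lambda>k. monomial [y] * dc_block y z ^ k) (dc_d y z) m))"
    unfolding alternating_def
  proof (rule conv_shuffle_reduction)
    show "dc_d y z k = monomial [La] * (monomial [y] * cd_power y z k + monomial [z] * cd_power z y k)" for k
      using dc_d_rec by (simp add: xa_def)
  qed (simp_all add: dc_d_commute[of z y] dc_block_def xa_def mult.assoc distrib_right)
  then show ?thesis
    by (simp add: alternating_def xa_def dc_d_commute[of z y] dc_block_commute[of z y])
qed

text \<open>Two recursion steps restore the letters and contribute 4 acc abb, so the induction
  advances by two.\<close>

lemma alternating_shuffle: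
  "alternating shuffle Lb Lc n =
     (- 2) ^ n * ((xa * xc ^ 2 * xa * xb ^ 2) ^ (n div 2) * (xa * xc ^ 2) ^ (n mod 2))"
proof (induction n rule: induct_nat_012)
  case 0
  show ?case
    by (simp add: alternating_def conv_def shuffle_one_left)
next
  case 1
  show ?case
    using alternating_shuffle_Suc[of Lb Lc 0]
    by (simp add: alternating_def[of _ _ _ 0] conv_def shuffle_one_left power2_eq_square mult.assoc
        flip: xc_def)
next
  case (ge2 n)
  have "alternating shuffle Lb Lc (Suc (Suc n)) =
      2 * (2 * ((xa * xc ^ 2 * xa * xb ^ 2) * alternating shuffle Lb Lc n))"
    by (simp add: alternating_shuffle_Suc power2_eq_square mult.assoc mult_2 mult_2_right
        algebra_simps flip: xb_def xc_def)
  \<comment> \<open>Integers are central, which lets the numeric factor move past the words.\<close>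
  moreover have "p * (- 2) ^ n = (- 2) ^ n * p" for p :: alg
    using mult_of_int_commute[of "(- 2) ^ n" p] by simp
  ultimately show ?case
    using ge2(1) by (simp flip: mult.assoc)
qed


section \<open>Symmetry under exchanging b and c, and evaluation of the stuffle sum\<close>

lemma xd_monomials: "xd = monomial [La, Lb] + monomial [La, Lc]"
  by (simp add: xd_def xa_def xb_def xc_def distrib_left flip: monomial_append)

lemma dc_block_monomials: "dc_block Lb Lc = monomial [La, Lb, Lc] + monomial [La, Lc, Lb]"
  by (simp add: dc_block_def xa_def distrib_left flip: monomial_append)

lemma dc_d_xd: "dc_d Lb Lc k = dc_block Lb Lc ^ k * xd"
  by (simp add: dc_d_def xd_def xb_def xc_def)

lemma swap_dc_block_power: "swap_alg (dc_block Lb Lc ^ k) = dc_block Lb Lc ^ k"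
  by (simp add: swap_alg_power dc_block_monomials swap_alg_add swap_alg_monomial add.commute)

lemma swap_dc_d: "swap_alg (dc_d Lb Lc k) = dc_d Lb Lc k"
  by (simp add: dc_d_xd swap_alg_mult swap_dc_block_power xd_monomials swap_alg_add swap_alg_monomial
      add.commute)

lemma swap_cd_power: "swap_alg (cd_power Lb Lc k) = cd_power Lc Lb k"
  by (cases k) (simp_all add: swap_alg_one swap_alg_mult swap_dc_d swap_alg_monomial
      dc_d_commute[of Lc Lb])

lemma gen_word_xs:
  "monomial (gen_word (Gamma 1)) = xc" "monomial (gen_word (Beta 2)) = xa * xb"
  "monomial (gen_word (Gamma 2)) = xa * xc" "monomial (gen_word (Beta 3)) = xa ^ 2 * xb"
  "monomial (gen_word (Gamma 3)) = xa ^ 2 * xc"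
  by (simp_all add: xa_def xb_def xc_def power2_eq_square numeral_eq_Suc flip: monomial_append)

lemma cons_c_dc_block_power: "cons_c (dc_block Lb Lc ^ k) = xc * dc_block Lb Lc ^ k"
  using gen_word_xs by (simp add: cons_c_def gen_cons_def swap_dc_block_power)

text \<open>N_{beta_2} gives abc p, while N_{gamma_2} exchanges the letters and gives acb p. This
  exchange is what models the star product of d and c.\<close>

lemma cons_d_xc_mult: "swap_alg p = p \<Longrightarrow> cons_d (xc * p) = dc_block Lb Lc * p"
  using gen_word_xs by (simp add: cons_d_def gen_cons_def swap_alg_mult swap_alg_letters
      dc_block_def distrib_left distrib_right mult.assoc flip: xb_def xc_def)

lemma alternating_stuffle_Suc:
  "alternating stuffle Lb Lc (Suc m) = - cons_e (alternating stuffle Lb Lc m)"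
proof -
  \<comment> \<open>The three facts are the hypotheses of the reduction: all P_i and S_i arise from
    1 by applying \<open>cons_c\<close> and \<open>cons_d\<close> alternately.\<close>
  have "dc_block Lb Lc ^ Suc k = cons_d (cons_c (dc_block Lb Lc ^ k))" for k
    by (simp add: cons_c_dc_block_power cons_d_xc_mult swap_dc_block_power)
  moreover have "cd_power Lb Lc (Suc k) = cons_c (dc_d Lb Lc k)" for k
    using gen_word_xs by (simp add: cons_c_def gen_cons_def swap_dc_d flip: xc_def)
  moreover have "dc_d Lb Lc k = cons_d (cd_power Lb Lc k)" for k
    using gen_word_xs by (simp add: cons_d_def gen_cons_def swap_cd_power dc_d_rec distrib_left
        mult.assoc flip: xb_def xc_def)
  ultimately have "conv stuffle (\<lambda>k. dc_block Lb Lc ^ k) (cd_power Lb Lc) (Suc (Suc m))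
      - conv stuffle (\<lambda>k. cons_c (dc_block Lb Lc ^ k)) (dc_d Lb Lc) (Suc m) =
      - cons_e (conv stuffle (\<lambda>k. dc_block Lb Lc ^ k) (cd_power Lb Lc) (Suc m)
      - conv stuffle (\<lambda>k. cons_c (dc_block Lb Lc ^ k)) (dc_d Lb Lc) m)"
    by (intro conv_stuffle_reduction) (rule power_0 cd_power.simps(1) | assumption)+
  then show ?thesis
    by (simp add: alternating_def cons_c_dc_block_power flip: xc_def)
qed

lemma alternating_stuffle: "alternating stuffle Lb Lc n = (- (xa ^ 2 * (xb + xc))) ^ n"
proof (induction n)
  case 0
  have "stuffle 1 1 = 1"
    using stuffle_one_left[of "[]"] by (simp add: in_A1_def monomial_Nil)
  then show ?case
    by (simp add: alternating_def conv_def)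
next
  case (Suc n)
  let ?e = "xa ^ 2 * (xb + xc)"
  \<comment> \<open>On elements fixed by the exchange, \<open>cons_e\<close> is left multiplication
    by a^2(b+c).\<close>
  have "swap_alg ((- ?e) ^ n) = (- ?e) ^ n"
  proof -
    have "swap_alg (- ?e) = - ?e"
      using alg_linear_diff[OF alg_linear_swap[OF alg_linear_ident], of 0 ?e]
      by (simp add: alg_linear_0[OF alg_linear_swap[OF alg_linear_ident]] swap_alg_mult swap_alg_power
          swap_alg_add swap_alg_letters add.commute)
    then show ?thesis
      by (simp add: swap_alg_power)
  qed
  then have "cons_e ((- ?e) ^ n) = ?e * (- ?e) ^ n"
    using gen_word_xs by (simp add: cons_e_def gen_cons_def distrib_left distrib_right)
  then show ?case
    using Suc by (simp add: alternating_stuffle_Suc)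
qed

section \<open>The star products\<close>

text \<open>The exceptional cases of the star product need a right factor beginning with b or
  c.\<close>

lemma star_La: "star p (monomial (La # w)) = p * monomial (La # w)"
proof (rule alg_linear_eqI[of "\<lambda>p. star p (monomial (La # w))" "\<lambda>p. p * monomial (La # w)"])
  show "star (monomial u) (monomial (La # w)) = monomial u * monomial (La # w)" for u
    by (simp add: star_def bilin_ext_mono star_word_def flip: monomial_append)
qed (intro alg_linear_intros)+

lemma star_xd: "star p xd = p * xd"
  by (simp add: xd_monomials star_add star_La distrib_left)

lemma star_last_xc:
  "star (p * monomial [La, Lb]) xc = p * monomial [La, Lb, Lc]"
  "star (p * monomial [La, Lc]) xc = p * monomial [La, Lc, Lb]"
proof -
  show "star (p * monomial [La, Lb]) xc = p * monomial [La, Lb, Lc]"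
  proof (rule alg_linear_eqI[of "\<lambda>p. star (p * monomial [La, Lb]) xc"
        "\<lambda>p. p * monomial [La, Lb, Lc]"])
    show "star (monomial u * monomial [La, Lb]) xc = monomial u * monomial [La, Lb, Lc]" for u
      by (simp add: star_def xc_def bilin_ext_mono star_word_def flip: monomial_append)
  qed (intro alg_linear_intros)+
  show "star (p * monomial [La, Lc]) xc = p * monomial [La, Lc, Lb]"
  proof (rule alg_linear_eqI[of "\<lambda>p. star (p * monomial [La, Lc]) xc"
        "\<lambda>p. p * monomial [La, Lc, Lb]"])
    show "star (monomial u * monomial [La, Lc]) xc = monomial u * monomial [La, Lc, Lb]" for u
      by (simp add: star_def xc_def bilin_ext_mono star_word_def flip: monomial_append)
  qed (intro alg_linear_intros)+
qed

lemma star_xd_xc: "star (p * xd) xc = p * dc_block Lb Lc"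
  by (simp add: xd_monomials dc_block_monomials star_add star_last_xc distrib_left)

lemma star_one_xc: "star 1 xc = xc"
  by (simp add: xc_def star_def bilin_ext_mono star_word_def flip: monomial_Nil)

lemma star_list_snoc: "star_list (ps @ [p]) = star (star_list ps) p"
  by (simp add: star_list_def)

lemma star_list_upt_snoc:
  "i \<le> j \<Longrightarrow> star_list (map block [i..<Suc j]) = star (star_list (map block [i..<j])) (block j)"
  by (simp add: star_list_snoc)

lemma star_list_empty: "star_list [] = 1"
  by (simp add: star_list_def)

lemma block_parity: "odd j \<Longrightarrow> block j = xc" "even j \<Longrightarrow> block j = xd"
  by (simp_all add: block_def)

text \<open>The first of four cases, by the parities of the first and last index; each added d is
  concatenated, and each c after a d completes a factor f.\<close>

lemma star_list_from_d:
  assumes "even i"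
  shows "star_list (map block [i..<i + 2 * k]) = dc_block Lb Lc ^ k"
proof (induction k)
  case 0
  show ?case by (simp add: star_list_empty)
next
  case (Suc k)
  have "star_list (map block [i..<i + 2 * Suc k]) =
      star (star (star_list (map block [i..<i + 2 * k])) (block (i + 2 * k))) (block (Suc (i + 2 * k)))"
    by (simp only: mult_Suc_right add_2_eq_Suc add_Suc_right)
      (simp add: star_list_upt_snoc del: upt_Suc)
  with Suc assms show ?case
    by (simp add: block_parity star_xd star_xd_xc power_commutes)
qed

lemma star_list_from_d_to_d:
  assumes "even i"
  shows "star_list (map block [i..<Suc (i + 2 * k)]) = dc_d Lb Lc k"
  using assms
  by (simp add: star_list_upt_snoc star_list_from_d block_parity star_xd dc_d_xd del: upt_Suc)

lemma star_list_from_c: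
  assumes "odd i"
  shows "star_list (map block [i..<Suc (i + 2 * k)]) = xc * dc_block Lb Lc ^ k"
proof (induction k)
  case 0
  show ?case
    using assms by (simp add: star_list_def block_parity star_one_xc)
next
  case (Suc k)
  have "star_list (map block [i..<Suc (i + 2 * Suc k)]) =
      star (star (star_list (map block [i..<Suc (i + 2 * k)])) (block (Suc (i + 2 * k))))
        (block (Suc (Suc (i + 2 * k))))"
    by (simp only: mult_Suc_right add_2_eq_Suc add_Suc_right)
      (simp add: star_list_upt_snoc del: upt_Suc)
  with Suc assms show ?case
    by (simp add: block_parity star_xd star_xd_xc del: upt_Suc)
      (simp add: power_commutes mult.assoc)
qed

lemma star_list_from_c_to_d:
  assumes "odd i"
  shows "star_list (map block [i..<i + 2 * k]) = cd_power Lb Lc k"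
proof (cases k)
  case 0
  then show ?thesis by (simp add: star_list_empty)
next
  case (Suc j)
  have "star_list (map block [i..<i + 2 * Suc j]) =
      star (star_list (map block [i..<Suc (i + 2 * j)])) (block (Suc (i + 2 * j)))"
    by (simp only: mult_Suc_right add_2_eq_Suc add_Suc_right)
      (simp add: star_list_upt_snoc del: upt_Suc)
  with Suc assms show ?thesis
    by (simp add: star_list_from_c block_parity star_xd dc_d_xd mult.assoc flip: xc_def del: upt_Suc)
qed

section \<open>Closed forms of S_i and P_i, and assembly of the identity\<close>

lemma S_elem_even: "k \<le> n \<Longrightarrow> S_elem n (2 * k) = cd_power Lb Lc (n - k)"
proof -
  assume "k \<le> n"
  then have "2 * k + 1 + 2 * (n - k) = 2 * n + 1"
    by simp
  with star_list_from_c_to_d[of "2 * k + 1" "n - k"] show ?thesis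
    by (simp add: S_elem_def del: upt_Suc)
qed

lemma S_elem_odd: "k < n \<Longrightarrow> S_elem n (Suc (2 * k)) = dc_d Lb Lc (n - Suc k)"
proof -
  assume "k < n"
  then have "Suc (2 * k + 2 + 2 * (n - Suc k)) = 2 * n + 1"
    by simp
  with star_list_from_d_to_d[of "2 * k + 2" "n - Suc k"] show ?thesis
    by (simp add: S_elem_def del: upt_Suc)
qed

lemma P_elem_odd: "P_elem (Suc (2 * k)) = xc * dc_block Lb Lc ^ k"
  using star_list_from_c[of 1 k] by (simp add: P_elem_def del: upt_Suc)

lemma P_elem_even: "P_elem (2 * k) = dc_block Lb Lc ^ k"
proof -
  \<comment> \<open>Blocks depend on parity only, and 2k - i and 2 + i have equal parity, so the
    reversed product is an increasing one starting with d.\<close>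
  have "map block (rev [1..<2 * k + 1]) = map block [2..<2 + 2 * k]"
  proof (rule nth_equalityI)
    fix i
    assume "i < length (map block (rev [1..<2 * k + 1]))"
    then have "i < 2 * k"
      by (simp del: upt_Suc)
    then have "rev [1..<2 * k + 1] ! i = 2 * k - i" "[2..<2 + 2 * k] ! i = 2 + i"
      by (simp_all add: rev_nth del: upt_Suc)
    with \<open>i < 2 * k\<close> show "map block (rev [1..<2 * k + 1]) ! i = map block [2..<2 + 2 * k] ! i"
      by (simp add: block_def del: upt_Suc)
  qed (simp del: upt_Suc)
  then show ?thesis
    using star_list_from_d[of 2 k] by (simp add: P_elem_def del: upt_Suc)
qed

lemma alternating_sum_even_odd:
  fixes t :: "nat \<Rightarrow> alg"
  shows "(\<Sum>i = 0..2 * n. (- 1) ^ i * t i) = (\<Sum>k<Suc n. t (2 * k)) - (\<Sum>k<n. t (Suc (2 * k)))"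
  by (induction n) simp_all

lemma alternating_sum_P_S:
  "(\<Sum>i = 0..2 * n. (- 1) ^ i * prd (P_elem i) (S_elem n i)) = alternating prd Lb Lc n"
  unfolding alternating_sum_even_odd alternating_def conv_def xc_def[symmetric]
  by (intro arg_cong2[of _ _ _ _ minus] sum.cong)
    (simp_all add: P_elem_even P_elem_odd S_elem_even S_elem_odd)

text \<open>The exponent n + i has the parity of n - i and avoids truncated subtraction for i > n;
  \<open>n mod 2\<close> is 2{n/2}.\<close>

theorem mainTheorem2:
  fixes n :: nat
  assumes "n \<ge> 1"
  shows "2 ^ n * ((xa * xc ^ 2 * xa * xb ^ 2) ^ (n div 2) * (xa * xc ^ 2) ^ (n mod 2))
    = (xa ^ 2 * (xb + xc)) ^ n + (\<Sum>i = 0..2 * n. (- 1) ^ (n + i) * Delta n i)"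
proof -
  \<comment> \<open>The global sign turns the values with bases -2 and -a^2(b+c) into those with
    bases 2 and a^2(b+c).\<close>
  have sign: "(- 1) ^ n * ((- 1) ^ n * p) = p" for p :: alg
  proof -
    have "(- 1) ^ n * (- 1) ^ n = (1 :: alg)"
      by (simp flip: power_add mult_2)
    then show ?thesis
      by (simp flip: mult.assoc)
  qed
  have "(\<Sum>i = 0..2 * n. (- 1) ^ (n + i) * Delta n i) =
      (- 1) ^ n * (alternating shuffle Lb Lc n - alternating stuffle Lb Lc n)"
    unfolding alternating_sum_P_S[symmetric]
    by (simp add: Delta_def power_add mult.assoc right_diff_distrib sum_subtractf
        flip: sum_distrib_left)
  also have "\<dots> = 2 ^ n * ((xa * xc ^ 2 * xa * xb ^ 2) ^ (n div 2) * (xa * xc ^ 2) ^ (n mod 2))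
      - (xa ^ 2 * (xb + xc)) ^ n"
    unfolding alternating_shuffle alternating_stuffle power_minus[of "xa ^ 2 * (xb + xc)"]
      power_minus[of 2]
    by (simp add: right_diff_distrib mult.assoc sign)
  finally show ?thesis
    by simp
qed

end
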